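(* Let $f$ be anisotropically strongly convex relative to $\phi$ with constant $\mu>0$ and let $g\in\Gamma_0(\mathbb{R}^n)$. Then $\operatorname{rge}\nabla f=\operatorname{rge}\nabla\phi$, and $F:=f+g$ is coercive and strictly convex relative to its effective domain, implying that it has a unique minimizer $x^\star$. In particular, $F$ satisfies the anisotropic proximal gradient dominance condition relative to $\phi$ with constant $\mu$ for any parameter $0<\lambda\le\mu^{-1}$, i.e., for all $\bar x\in\mathbb{R}^n$ $$\mu\big(F(\bar x)-F(x^\star)\big)\le\mathcal{G}_F^\phi(\bar x,\lambda).$$
   Context: $\Gamma_0(\mathbb{R}^n)$: proper lower semicontinuous convex functions $\mathbb{R}^n\to\overline{\mathbb{R}}$. Reference function: $\phi\in\Gamma_0(\mathbb{R}^n)$ has $\operatorname{dom}\phi=\mathbb{R}^n$ and is Legendre (essentially smooth and essentially strictly convex in the sense of Rockafellar); so $\nabla\phi:\mathbb{R}^n\to\operatorname{int}\operatorname{dom}\phi^*$ is a bijection with inverse $\nabla\phi^*$ ($\phi^*$ the convex conjugate). For $\lambda>0$, $(\lambda\star\phi)(x)=\lambda\phi(\lambda^{-1}x)$. $\phi_-(x):=\phi(-x)$ and $\phi_-^*:=(\phi_-)^*=\phi^*(-\,\cdot)$; $\operatorname{rge}$ denotes the range. Standing assumptions: $f\in\mathcal{C}^1(\mathbb{R}^n)$ has the anisotropic descent property relative to $\phi$ with constant $L>0$, i.e., $\operatorname{rge}\nabla f\subseteq\operatorname{rge}\nabla\phi$ and for all $\bar x,x\in\mathbb{R}^n$ $$f(x)\le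 f(\bar x)+\tfrac1L\star\phi\big(x-\bar x+L^{-1}\nabla\phi^*(\nabla f(\bar x))\big)-\tfrac1L\star\phi\big(L^{-1}\nabla\phi^*(\nabla f(\bar x))\big);$$ $g$ is proper lower semicontinuous; $\inf(f+g)>-\infty$; and, $g$ being convex, $\operatorname{dom}g^*\cap\operatorname{int}(\operatorname{dom}\phi_-^* )\ne\emptyset$. Anisotropic strong convexity relative to $\phi$ with constant $\mu>0$ of $f\in\Gamma_0(\mathbb{R}^n)$: $\operatorname{rge}\partial f\supseteq\operatorname{rge}\nabla\phi$ and for all $(\bar x,\bar v)\in\operatorname{gph}\partial f\cap(\mathbb{R}^n\times\operatorname{int}\operatorname{dom}\phi^* )$ $$f(x)\ge f(\bar x)+\tfrac1\mu\star\phi\big(x-\bar x+\mu^{-1}\nabla\phi^*(\bar v)\big)-\tfrac1\mu\star\phi\big(\mu^{-1}\nabla\phi^*(\bar v)\big)\quad\forall x\in\mathbb{R}^n.$$ Regularized gap: for $\lambda>0$, $\mathcal{G}_F^\phi(\bar x,\lambda):=\tfrac1\lambda\big(F(\bar x)-F_\lambda(\bar x)\big)$, where $$F_\lambda(\bar x):=\inf_{x\in\mathbb{R}^n}\Big\{f(\bar x)+\lambda\star\phi\big(x-\bar x+\lambda\nabla\phi^*(\nabla f(\bar x))\big)-\lambda\star\phi\big(\lambda\nabla\phi^*(\nabla f(\bar x))\big)+g(x)\Big\}.$$ The anisotropic proximal gradient dominance condition relative to $\phi$ with constant $\mu$ for parameter $\lambda$ means $\mu(F(\bar x)-\inf F)\le\mathcal{G}_F^\phi(\bar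 x,\lambda)$ for all $\bar x\in\mathbb{R}^n$. Coercive means $F(x)\to+\infty$ as $\|x\|\to\infty$. *)

theory Defs
  imports "HOL-Analysis.Analysis"
begin

definition edom :: "('a \<Rightarrow> ereal) \<Rightarrow> 'a set" where
  "edom h = {x. h x < \<infinity>}"

definition proper_fun :: "('a \<Rightarrow> ereal) \<Rightarrow> bool" where
  "proper_fun h \<longleftrightarrow> (\<forall>x. h x \<noteq> -\<infinity>) \<and> edom h \<noteq> {}"

definition lsc_fun :: "('a::topological_space \<Rightarrow> ereal) \<Rightarrow> bool" where
  "lsc_fun h \<longleftrightarrow> (\<forall>x. h x \<le> Liminf (at x) h)"

definition convex_fun :: "('a::real_vector \<Rightarrow> ereal) \<Rightarrow> bool" where
  "convex_fun h \<longleftrightarrow> convex {(x, r::real). h x \<le> ereal r}"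

definition Gamma0 :: "('a::real_normed_vector \<Rightarrow> ereal) set" where
  "Gamma0 = {h. proper_fun h \<and> lsc_fun h \<and> convex_fun h}"

definition strictly_convex_fun_on :: "'a::real_vector set \<Rightarrow> ('a \<Rightarrow> ereal) \<Rightarrow> bool" where
  "strictly_convex_fun_on S h \<longleftrightarrow>
     (\<forall>x\<in>S. \<forall>y\<in>S. \<forall>t::real. x \<noteq> y \<longrightarrow> 0 < t \<longrightarrow> t < 1 \<longrightarrow>
        h ((1 - t) *\<^sub>R x + t *\<^sub>R y) < ereal (1 - t) * h x + ereal t * h y)"

definition conj_fun :: "('a::real_inner \<Rightarrow> ereal) \<Rightarrow> 'a \<Rightarrow> ereal" where
  "conj_fun h v = (SUP x. ereal (v \<bullet> x) - h x)"

definition grad :: "('a::real_inner \<Rightarrow> real) \<Rightarrow> 'a \<Rightarrow> 'a" where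
  "grad f x = (THE v. GDERIV f x :> v)"

(* For an extended-valued h this is only meaningful at points near which h is finite;
   elsewhere real_of_ereal replaces infinite values by 0.  It is used below only on
   interiors of domains of proper functions. *)
definition egrad :: "('a::real_inner \<Rightarrow> ereal) \<Rightarrow> 'a \<Rightarrow> 'a" where
  "egrad h = grad (\<lambda>x. real_of_ereal (h x))"

definition subdiff :: "('a::real_inner \<Rightarrow> ereal) \<Rightarrow> 'a \<Rightarrow> 'a set" where
  "subdiff h x = {v. \<bar>h x\<bar> \<noteq> \<infinity> \<and> (\<forall>y. h x + ereal (v \<bullet> (y - x)) \<le> h y)}"

(* Legendre functions as in Rockafellar, "Convex Analysis", Section 26. *)

definition essentially_smooth :: "('a::euclidean_space \<Rightarrow> ereal) \<Rightarrow> bool" where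
  "essentially_smooth h \<longleftrightarrow>
     interior (edom h) \<noteq> {} \<and>
     (\<forall>x\<in>interior (edom h). (\<lambda>y. real_of_ereal (h y)) differentiable (at x)) \<and>
     (\<forall>X x. (\<forall>i::nat. X i \<in> interior (edom h)) \<longrightarrow> x \<in> frontier (interior (edom h)) \<longrightarrow>
        X \<longlonglongrightarrow> x \<longrightarrow> filterlim (\<lambda>i. norm (egrad h (X i))) at_top sequentially)"

definition essentially_strictly_convex :: "('a::euclidean_space \<Rightarrow> ereal) \<Rightarrow> bool" where
  "essentially_strictly_convex h \<longleftrightarrow>
     (\<forall>S. convex S \<longrightarrow> S \<subseteq> {x. subdiff h x \<noteq> {}} \<longrightarrow> strictly_convex_fun_on S h)"

definition legendre :: "('a::euclidean_space \<Rightarrow> ereal) \<Rightarrow> bool" where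
  "legendre h \<longleftrightarrow> essentially_smooth h \<and> essentially_strictly_convex h"

definition reference_function :: "('a::euclidean_space \<Rightarrow> ereal) \<Rightarrow> bool" where
  "reference_function \<phi> \<longleftrightarrow> \<phi> \<in> Gamma0 \<and> edom \<phi> = UNIV \<and> legendre \<phi>"

definition C1_fun :: "('a::euclidean_space \<Rightarrow> real) \<Rightarrow> bool" where
  "C1_fun f \<longleftrightarrow> (\<forall>x. f differentiable (at x)) \<and> continuous_on UNIV (grad f)"

definition epi_scale :: "real \<Rightarrow> ('a::real_vector \<Rightarrow> ereal) \<Rightarrow> 'a \<Rightarrow> ereal" where
  "epi_scale c \<phi> x = ereal c * \<phi> (inverse c *\<^sub>R x)"

definition aniso_descent ::
    "('a::euclidean_space \<Rightarrow> ereal) \<Rightarrow> real \<Rightarrow> ('a \<Rightarrow> real) \<Rightarrow> bool" where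
  "aniso_descent \<phi> L f \<longleftrightarrow>
     range (grad f) \<subseteq> range (egrad \<phi>) \<and>
     (\<forall>xb x. ereal (f x) \<le>
        ereal (f xb)
        + epi_scale (1/L) \<phi> (x - xb + inverse L *\<^sub>R egrad (conj_fun \<phi>) (grad f xb))
        - epi_scale (1/L) \<phi> (inverse L *\<^sub>R egrad (conj_fun \<phi>) (grad f xb)))"

definition aniso_strongly_convex ::
    "('a::euclidean_space \<Rightarrow> ereal) \<Rightarrow> real \<Rightarrow> ('a \<Rightarrow> ereal) \<Rightarrow> bool" where
  "aniso_strongly_convex \<phi> \<mu> f \<longleftrightarrow>
     f \<in> Gamma0 \<and>
     range (egrad \<phi>) \<subseteq> (\<Union>x. subdiff f x) \<and>
     (\<forall>xb. \<forall>vb \<in> subdiff f xb \<inter> interior (edom (conj_fun \<phi>)). \<forall>x.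
        f x \<ge>
        f xb
        + epi_scale (1/\<mu>) \<phi> (x - xb + inverse \<mu> *\<^sub>R egrad (conj_fun \<phi>) vb)
        - epi_scale (1/\<mu>) \<phi> (inverse \<mu> *\<^sub>R egrad (conj_fun \<phi>) vb))"

definition objective :: "('a \<Rightarrow> real) \<Rightarrow> ('a \<Rightarrow> ereal) \<Rightarrow> 'a \<Rightarrow> ereal" where
  "objective f g x = ereal (f x) + g x"

definition fb_envelope ::
    "('a::euclidean_space \<Rightarrow> ereal) \<Rightarrow> ('a \<Rightarrow> real) \<Rightarrow> ('a \<Rightarrow> ereal) \<Rightarrow> real \<Rightarrow> 'a \<Rightarrow> ereal" where
  "fb_envelope \<phi> f g c xb =
     (INF x. ereal (f xb)
        + epi_scale c \<phi> (x - xb + c *\<^sub>R egrad (conj_fun \<phi>) (grad f xb))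
        - epi_scale c \<phi> (c *\<^sub>R egrad (conj_fun \<phi>) (grad f xb))
        + g x)"

definition reg_gap ::
    "('a::euclidean_space \<Rightarrow> ereal) \<Rightarrow> ('a \<Rightarrow> real) \<Rightarrow> ('a \<Rightarrow> ereal) \<Rightarrow> 'a \<Rightarrow> real \<Rightarrow> ereal" where
  "reg_gap \<phi> f g xb c = ereal (1/c) * (objective f g xb - fb_envelope \<phi> f g c xb)"

definition aniso_pg_dominance ::
    "('a::euclidean_space \<Rightarrow> ereal) \<Rightarrow> ('a \<Rightarrow> real) \<Rightarrow> ('a \<Rightarrow> ereal) \<Rightarrow> real \<Rightarrow> real \<Rightarrow> bool" where
  "aniso_pg_dominance \<phi> f g \<mu> c \<longleftrightarrow>
     (\<forall>xb. ereal \<mu> * (objective f g xb - (INF x. objective f g x)) \<le> reg_gap \<phi> f g xb c)"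

definition coercive_fun :: "('a::real_normed_vector \<Rightarrow> ereal) \<Rightarrow> bool" where
  "coercive_fun F \<longleftrightarrow> (F \<longlongrightarrow> \<infinity>) at_infinity"

definition minimizer :: "('a \<Rightarrow> ereal) \<Rightarrow> 'a \<Rightarrow> bool" where
  "minimizer F x \<longleftrightarrow> (\<forall>y. F x \<le> F y)"

end

theory Submission
  imports Defs
begin

text \<open>
  Write \<open>\<phi>\<close> as a real function \<open>p\<close>; the Legendre property makes \<open>p\<close> differentiable and
  strictly convex. The gradients of \<open>f\<close> and \<open>\<phi>\<close> have the same range: one inclusion is part of the
  descent property, and the other is part of strong convexity, because the gradient is the only
  subgradient of a differentiable convex function. The rest depends on reading the strong convexity inequality at a base
  point \<open>x\<close> through the point \<open>y x = \<nabla>\<phi>\<^sup>*(\<nabla>f x)\<close>, where it becomes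
  \<open>f z \<ge> f x + (p (\<mu> (z - x) + y x) - p (y x)) / \<mu>\<close> for all \<open>z\<close>.

  To use it, one needs \<open>\<nabla>p (y x) = \<nabla>f x\<close> and that \<open>\<nabla>f x\<close> is interior to \<open>dom \<phi>\<^sup>*\<close>. Both follow
  from one estimate: a convex function with a strict minimizer grows at least linearly away from
  it (\<open>convex_strict_min_linear_growth\<close>). Applied to \<open>p - \<langle>v, \<cdot>\<rangle>\<close> with \<open>v = \<nabla>p u\<close>, it shows that
  \<open>\<phi>\<^sup>*\<close> is finite near \<open>v\<close> and differentiable there with gradient \<open>u\<close>
  (\<open>conj_fun_le_near_gradient\<close>, \<open>egrad_conj_fun_at_gradient\<close>).
  Since \<open>\<nabla>f x\<close> is in the range of \<open>\<nabla>p\<close>, this applies to \<open>v = \<nabla>f x\<close>.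

  \<^item> Strict convexity: strict tangent inequalities for \<open>p\<close> at \<open>y x\<close> turn into strict tangent
    inequalities for \<open>f\<close> at \<open>x\<close>.

  \<^item> Coercivity: if \<open>w\<close> lies in \<open>dom g\<^sup>*\<close> and \<open>-w\<close> in the interior of \<open>dom \<phi>\<^sup>*\<close>, then \<open>-w = \<nabla>f x0\<close>
    for some \<open>x0\<close> (\<open>interior_conj_domain_subset_range_grad\<close>), so \<open>f + \<langle>w, \<cdot>\<rangle>\<close> has the strict
    minimizer \<open>x0\<close> and grows linearly, while \<open>g - \<langle>w, \<cdot>\<rangle>\<close> is bounded below. Together with lower
    semicontinuity this gives the minimizer.

  \<^item> Dominance: in the infimum defining \<open>F\<^sub>\<lambda>\<close> at \<open>xb\<close>, insert the point \<open>(1 - t) xb + t xs\<close> with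
    \<open>t = \<lambda>\<mu> \<le> 1\<close>. Its displacement divided by \<open>\<lambda>\<close> is \<open>\<mu> (xs - xb)\<close>, exactly the displacement in
    the strong convexity inequality; with the convexity of \<open>g\<close> this bounds \<open>F\<^sub>\<lambda> xb\<close> by
    \<open>(1 - t) F xb + t F xs\<close> (\<open>fb_envelope_le_interpolation\<close>).
\<close>

section \<open>Gradients and convexity\<close>

lemma convex_fun_ereal_iff: "convex_fun (\<lambda>x. ereal (p x)) \<longleftrightarrow> convex_on UNIV p"
proof -
  have "{(x, r::real). ereal (p x) \<le> ereal r} = epigraph UNIV p"
    by (auto simp: epigraph_def)
  then show ?thesis
    by (simp add: convex_fun_def convex_epigraph)
qed

lemma convex_fun_segment_le:
  assumes "convex_fun g" "g x \<le> ereal a" "g y \<le> ereal b" "0 \<le> t" "t \<le> 1"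
  shows "g ((1 - t) *\<^sub>R x + t *\<^sub>R y) \<le> ereal ((1 - t) * a + t * b)"
proof -
  have "(1 - t) *\<^sub>R (x, a) + t *\<^sub>R (y, b) \<in> {(x, r::real). g x \<le> ereal r}"
    by (rule convexD[OF assms(1)[unfolded convex_fun_def]]) (use assms in auto)
  then show ?thesis by simp
qed

lemma GDERIV_unique:
  fixes f :: "'a::real_inner \<Rightarrow> real"
  assumes "GDERIV f x :> v" "GDERIV f x :> w"
  shows "v = w"
proof -
  have "(\<lambda>h. h \<bullet> v) = (\<lambda>h. h \<bullet> w)"
    using has_derivative_unique assms unfolding gderiv_def by blast
  then have "\<forall>h. h \<bullet> v = h \<bullet> w" by metis
  then show ?thesis by (simp add: vector_eq_ldot)
qed

text \<open>
  In a Euclidean space a differentiable function has a gradient vector, whose coordinates are the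
  values of the derivative on the basis; hence the description operator in \<open>grad\<close> is well defined.
\<close>

lemma GDERIV_grad:
  fixes f :: "'a::euclidean_space \<Rightarrow> real"
  assumes "f differentiable (at x)"
  shows "GDERIV f x :> grad f x"
proof -
  obtain f' where f': "(f has_derivative f') (at x)"
    using assms by (auto simp: differentiable_def)
  then have lin: "bounded_linear f'" by (rule has_derivative_bounded_linear)
  define v where "v = (\<Sum>b\<in>Basis. f' b *\<^sub>R b)"
  have "f' = (\<lambda>h. h \<bullet> v)"
  proof
    fix h
    have "f' h = f' (\<Sum>b\<in>Basis. (h \<bullet> b) *\<^sub>R b)" by (simp add: euclidean_representation)
    also have "\<dots> = (\<Sum>b\<in>Basis. (h \<bullet> b) * f' b)"
      using bounded_linear.linear[OF lin]
      by (simp add: linear_sum linear_cmul)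
    also have "\<dots> = h \<bullet> v" by (simp add: v_def inner_sum_right mult.commute)
    finally show "f' h = h \<bullet> v" .
  qed
  with f' have "GDERIV f x :> v" by (simp add: gderiv_def)
  then show ?thesis
    using GDERIV_unique theI unfolding grad_def by metis
qed

text \<open>
  Subtracting the linear function of \<open>v\<close> leaves a function with a global minimum at \<open>x\<close>, whose
  derivative there must vanish.
\<close>

lemma GDERIV_subgradient_eq:
  fixes f :: "'a::real_inner \<Rightarrow> real"
  assumes der: "GDERIV f x :> d" and sub: "\<And>y. f x + v \<bullet> (y - x) \<le> f y"
  shows "v = d"
proof -
  have "GDERIV (\<lambda>y. y \<bullet> v) x :> v"
    unfolding gderiv_def by (auto intro!: derivative_eq_intros)
  with der have "GDERIV (\<lambda>y. f y - y \<bullet> v) x :> d - v" by (rule GDERIV_diff)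
  then have "(\<lambda>h. h \<bullet> (d - v)) = (\<lambda>h. 0)"
    unfolding gderiv_def
    by (rule differential_zero_maxmin[rotated 2, where S=UNIV])
       (use sub in \<open>auto simp: inner_diff_right inner_commute algebra_simps\<close>)
  then have "(d - v) \<bullet> (d - v) = 0" by metis
  then show ?thesis by simp
qed

lemma GDERIV_imp_grad:
  fixes f :: "'a::real_inner \<Rightarrow> real"
  assumes "GDERIV f x :> d"
  shows "grad f x = d"
  unfolding grad_def using assms GDERIV_unique by blast

text \<open>
  Restriction to the line through \<open>x\<close> and \<open>y\<close> reduces this to the tangent inequality in one
  dimension.
\<close>

lemma convex_on_above_gradient:
  fixes f :: "'a::real_inner \<Rightarrow> real"
  assumes conv: "convex_on UNIV f" and der: "GDERIV f x :> v"
  shows "f x + v \<bullet> (y - x) \<le> f y"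
proof -
  define q where "q = (\<lambda>t. f (x + t *\<^sub>R (y - x)))"
  have "convex_on UNIV q"
  proof (rule convex_onI)
    fix t a b :: real
    assume t: "0 < t" "t < 1"
    have "x + ((1 - t) * a + t * b) *\<^sub>R (y - x)
        = (1 - t) *\<^sub>R (x + a *\<^sub>R (y - x)) + t *\<^sub>R (x + b *\<^sub>R (y - x))"
      by (simp add: algebra_simps)
    then show "q ((1 - t) *\<^sub>R a + t *\<^sub>R b) \<le> (1 - t) * q a + t * q b"
      using convex_onD[OF conv, of t "x + a *\<^sub>R (y - x)" "x + b *\<^sub>R (y - x)"] t
      by (simp add: q_def)
  qed simp
  moreover have "(q has_field_derivative v \<bullet> (y - x)) (at 0)"
  proof -
    have g: "((\<lambda>t::real. x + t *\<^sub>R (y - x)) has_derivative (\<lambda>t. t *\<^sub>R (y - x))) (at 0)"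
      by (auto intro!: derivative_eq_intros)
    have "(f has_derivative (\<lambda>h. h \<bullet> v)) (at (x + 0 *\<^sub>R (y - x)))"
      using der by (simp add: gderiv_def)
    from has_derivative_compose[OF g this] show ?thesis
      by (simp add: q_def has_field_derivative_def inner_commute mult.commute[of "v \<bullet> (y - x)"]
        mult_commute_abs)
  qed
  ultimately have "(v \<bullet> (y - x)) * (1 - 0) \<le> q 1 - q 0"
    by (intro convex_on_imp_above_tangent[of UNIV]) auto
  then show ?thesis by (simp add: q_def)
qed

text \<open>
  Strictness comes from the midpoint of \<open>x\<close> and \<open>y\<close>: there \<open>f\<close> lies above the tangent and strictly
  below the chord.
\<close>

lemma strictly_convex_above_gradient:
  fixes f :: "'a::real_inner \<Rightarrow> real"
  assumes conv: "convex_on UNIV f" and str: "strictly_convex_fun_on UNIV (\<lambda>x. ereal (f x))"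
    and der: "GDERIV f x :> v" and "y \<noteq> x"
  shows "f x + v \<bullet> (y - x) < f y"
proof -
  define m where "m = (1/2) *\<^sub>R x + (1/2) *\<^sub>R y"
  have "ereal (f ((1 - 1/2) *\<^sub>R x + (1/2) *\<^sub>R y)) < ereal (1 - 1/2) * ereal (f x) + ereal (1/2) * ereal (f y)"
    using str[unfolded strictly_convex_fun_on_def, rule_format, of x y "1/2"] \<open>y \<noteq> x\<close> by auto
  then have "f m < f x / 2 + f y / 2" by (simp add: m_def)
  moreover have "f x + v \<bullet> (m - x) \<le> f m" by (rule convex_on_above_gradient[OF conv der])
  moreover have "m - x = (1/2) *\<^sub>R (y - x)"
  proof -
    have "x = (1/2) *\<^sub>R x + (1/2) *\<^sub>R x" by (simp flip: scaleR_add_left)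
    then show ?thesis by (simp add: m_def algebra_simps)
  qed
  ultimately show ?thesis by (simp)
qed

text \<open>
  The tangent inequalities at the intermediate point, weighted by \<open>1 - t\<close> and \<open>t\<close>, add up so that
  the linear terms cancel.
\<close>

lemma strictly_convex_if_above_tangents:
  fixes f :: "'a::real_inner \<Rightarrow> real"
  assumes tan: "\<And>x y. y \<noteq> x \<Longrightarrow> f x + v x \<bullet> (y - x) < f y"
    and "x \<noteq> y" and t: "0 < t" "t < 1"
  shows "f ((1 - t) *\<^sub>R x + t *\<^sub>R y) < (1 - t) * f x + t * f y"
proof -
  define z where "z = (1 - t) *\<^sub>R x + t *\<^sub>R y"
  have dx: "x - z = (- t) *\<^sub>R (y - x)" and dy: "y - z = (1 - t) *\<^sub>R (y - x)"
    by (simp_all add: z_def algebra_simps)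
  have "x \<noteq> z" "y \<noteq> z" using dx dy \<open>x \<noteq> y\<close> t by auto
  then have "f z + v z \<bullet> (x - z) < f x" "f z + v z \<bullet> (y - z) < f y"
    using tan by blast+
  then have "(1 - t) * (f z + (- t) * (v z \<bullet> (y - x))) < (1 - t) * f x"
      "t * (f z + (1 - t) * (v z \<bullet> (y - x))) < t * f y"
    using t unfolding dx dy by simp_all
  then show ?thesis unfolding z_def[symmetric] by (simp add: algebra_simps)
qed

text \<open>
  On the sphere of radius \<open>r\<close> around the minimizer, compactness gives a positive gap above the
  minimum; convexity along rays makes this gap grow at least proportionally to the distance.
\<close>

lemma convex_strict_min_linear_growth:
  fixes h :: "'a::euclidean_space \<Rightarrow> real"
  assumes conv: "convex_on UNIV h" and strict: "\<And>x. x \<noteq> x0 \<Longrightarrow> h x0 < h x" and "0 < r"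
  obtains m where "0 < m" "\<And>x. r \<le> norm (x - x0) \<Longrightarrow> h x0 + m * norm (x - x0) \<le> h x"
proof -
  have "continuous_on UNIV h" by (rule convex_on_continuous[OF open_UNIV conv])
  then have "continuous_on (sphere x0 r) h" by (rule continuous_on_subset) simp
  then obtain z where z: "z \<in> sphere x0 r" "\<And>y. y \<in> sphere x0 r \<Longrightarrow> h z \<le> h y"
    using continuous_attains_inf[of "sphere x0 r" h] \<open>0 < r\<close> by auto
  from z(1) \<open>0 < r\<close> have "z \<noteq> x0" by auto
  define m where "m = (h z - h x0) / r"
  show thesis
  proof
    show "0 < m" using strict[OF \<open>z \<noteq> x0\<close>] \<open>0 < r\<close> by (simp add: m_def)
    fix x assume x: "r \<le> norm (x - x0)"
    define s where "s = r / norm (x - x0)"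
    have "0 < norm (x - x0)" using x \<open>0 < r\<close> by linarith
    then have "x \<noteq> x0" and s: "0 < s" "s \<le> 1" using x \<open>0 < r\<close> by (auto simp add: s_def)
    define u where "u = (1 - s) *\<^sub>R x0 + s *\<^sub>R x"
    have "u - x0 = s *\<^sub>R (x - x0)" by (simp add: u_def algebra_simps)
    then have "norm (u - x0) = r" using \<open>x \<noteq> x0\<close> \<open>0 < r\<close> by (simp add: s_def)
    then have "h z \<le> h u" by (intro z(2)) (simp add: dist_norm norm_minus_commute)
    also have "\<dots> \<le> (1 - s) * h x0 + s * h x"
      unfolding u_def using convex_onD[OF conv, of s x0 x] s by auto
    finally have "h z - h x0 \<le> s * (h x - h x0)" by (simp add: algebra_simps)
    then have "(h z - h x0) * norm (x - x0) \<le> r * (h x - h x0)"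
      using \<open>x \<noteq> x0\<close> by (simp add: s_def pos_le_divide_eq)
    then show "h x0 + m * norm (x - x0) \<le> h x"
      using \<open>0 < r\<close> by (simp add: m_def field_simps)
  qed
qed


lemma convex_on_add_inner:
  fixes h :: "'a::real_inner \<Rightarrow> real"
  assumes "convex_on UNIV h"
  shows "convex_on UNIV (\<lambda>x. h x + w \<bullet> x)"
proof (rule convex_on_add[OF assms])
  show "convex_on UNIV ((\<bullet>) w)"
    by (rule convex_onI) (auto simp: inner_add_right)
qed

section \<open>The conjugate at a gradient\<close>

lemma conj_fun_ge_affine: "ereal (v \<bullet> x - p x) \<le> conj_fun (\<lambda>x. ereal (p x)) v"
  unfolding conj_fun_def by (rule SUP_upper2[of x]) auto

text \<open>
  The supremum defining the conjugate at \<open>w\<close> is that of \<open>\<langle>w - v, \<cdot>\<rangle> - h\<close>, where \<open>h = p - \<langle>v, \<cdot>\<rangle>\<close> has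
  the strict minimizer \<open>x\<close>. If \<open>w\<close> is close to \<open>v\<close>, the linear growth of \<open>h\<close> outside the ball of
  radius \<open>r\<close> beats the linear term, and inside the ball moving away from \<open>x\<close> gains at most
  \<open>r * norm (w - v)\<close>. Since \<open>r\<close> is arbitrary, this is a first-order upper expansion of the
  conjugate at \<open>v\<close>, matching the lower bound \<open>conj_fun_ge_affine\<close>.
\<close>

lemma conj_fun_le_near_gradient:
  fixes p :: "'a::euclidean_space \<Rightarrow> real"
  assumes conv: "convex_on UNIV p" and strict: "\<And>y. y \<noteq> x \<Longrightarrow> p x + v \<bullet> (y - x) < p y" and "0 < r"
  obtains m where "0 < m"
    "\<And>w. norm (w - v) \<le> m \<Longrightarrow>
       conj_fun (\<lambda>x. ereal (p x)) w \<le> ereal (w \<bullet> x - p x + r * norm (w - v))"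
proof -
  define h where "h = (\<lambda>y. p y + (- v) \<bullet> y)"
  have "convex_on UNIV h" unfolding h_def by (rule convex_on_add_inner[OF conv])
  moreover have hx: "h x < h y" if "y \<noteq> x" for y
    using strict[OF that] by (simp add: h_def inner_diff_right)
  ultimately obtain m where "0 < m"
    and m: "\<And>y. r \<le> norm (y - x) \<Longrightarrow> h x + m * norm (y - x) \<le> h y"
    using convex_strict_min_linear_growth[of h x r] \<open>0 < r\<close> by metis
  show thesis
  proof
    fix w assume w: "norm (w - v) \<le> m"
    show "conj_fun (\<lambda>x. ereal (p x)) w \<le> ereal (w \<bullet> x - p x + r * norm (w - v))"
      unfolding conj_fun_def
    proof (rule SUP_least)
      fix y
      have cs: "(w - v) \<bullet> (y - x) \<le> norm (w - v) * norm (y - x)"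
        by (rule norm_cauchy_schwarz)
      have "(w - v) \<bullet> (y - x) + h x \<le> h y + r * norm (w - v)"
      proof (cases "r \<le> norm (y - x)")
        case True
        have "norm (w - v) * norm (y - x) \<le> m * norm (y - x)"
          using w by (rule mult_right_mono) simp
        with cs m[OF True] have "(w - v) \<bullet> (y - x) + h x \<le> h y" by simp
        moreover have "0 \<le> r * norm (w - v)" using \<open>0 < r\<close> by simp
        ultimately show ?thesis by linarith
      next
        case False
        then have "norm (w - v) * norm (y - x) \<le> norm (w - v) * r"
          by (intro mult_left_mono) auto
        moreover have "h x \<le> h y" using hx[of y] by (cases "y = x") auto
        ultimately show ?thesis using cs by (simp add: mult.commute)
      qed
      then show "ereal (w \<bullet> y) - ereal (p y) \<le> ereal (w \<bullet> x - p x + r * norm (w - v))"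
        by (simp add: h_def inner_diff_left inner_diff_right)
    qed
  qed fact
qed

lemma gradient_in_interior_conj_domain:
  fixes p :: "'a::euclidean_space \<Rightarrow> real"
  assumes conv: "convex_on UNIV p" and strict: "\<And>y. y \<noteq> x \<Longrightarrow> p x + v \<bullet> (y - x) < p y"
  shows "v \<in> interior (edom (conj_fun (\<lambda>x. ereal (p x))))"
proof -
  obtain m where "0 < m"
    and m: "\<And>w. norm (w - v) \<le> m \<Longrightarrow>
       conj_fun (\<lambda>x. ereal (p x)) w \<le> ereal (w \<bullet> x - p x + 1 * norm (w - v))"
    using conj_fun_le_near_gradient[OF conv strict zero_less_one] by blast
  have "ball v m \<subseteq> edom (conj_fun (\<lambda>x. ereal (p x)))"
  proof
    fix w assume "w \<in> ball v m"
    then have "norm (w - v) \<le> m" by (simp add: dist_norm norm_minus_commute)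
    from m[OF this] show "w \<in> edom (conj_fun (\<lambda>x. ereal (p x)))"
      unfolding edom_def by (auto intro: le_less_trans)
  qed
  then show ?thesis
    using \<open>0 < m\<close> by (meson centre_in_ball interiorI open_ball)
qed

text \<open>
  This is \<open>\<nabla>p\<^sup>* (\<nabla>p x) = x\<close>: near \<open>v\<close> the conjugate is squeezed between its supporting affine
  function with slope \<open>x\<close> and that function plus an arbitrarily small multiple of the distance.
\<close>

lemma egrad_conj_fun_at_gradient:
  fixes p :: "'a::euclidean_space \<Rightarrow> real"
  assumes conv: "convex_on UNIV p" and strict: "\<And>y. y \<noteq> x \<Longrightarrow> p x + v \<bullet> (y - x) < p y"
  shows "egrad (conj_fun (\<lambda>x. ereal (p x))) v = x"
proof -
  let ?c = "\<lambda>w. real_of_ereal (conj_fun (\<lambda>x. ereal (p x)) w)"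
  have near: "\<exists>m>0. \<forall>w. norm (w - v) \<le> m \<longrightarrow>
      w \<bullet> x - p x \<le> ?c w \<and> ?c w \<le> w \<bullet> x - p x + r * norm (w - v)" if "0 < r" for r
  proof -
    obtain m where "0 < m"
      and m: "\<And>w. norm (w - v) \<le> m \<Longrightarrow>
         conj_fun (\<lambda>x. ereal (p x)) w \<le> ereal (w \<bullet> x - p x + r * norm (w - v))"
      using conj_fun_le_near_gradient[OF conv strict \<open>0 < r\<close>] by blast
    have "w \<bullet> x - p x \<le> ?c w \<and> ?c w \<le> w \<bullet> x - p x + r * norm (w - v)" if "norm (w - v) \<le> m" for w
      using m[OF that] conj_fun_ge_affine[of w x p]
      by (cases "conj_fun (\<lambda>x. ereal (p x)) w") auto
    with \<open>0 < m\<close> show ?thesis by blast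
  qed
  have cv: "?c v = v \<bullet> x - p x"
  proof -
    obtain m where "0 < m" and m: "\<And>w. norm (w - v) \<le> m \<Longrightarrow>
        w \<bullet> x - p x \<le> ?c w \<and> ?c w \<le> w \<bullet> x - p x + 1 * norm (w - v)"
      using near[OF zero_less_one] by blast
    then show ?thesis using m[of v] by (intro antisym) auto
  qed
  have "GDERIV ?c v :> x"
    unfolding gderiv_def has_derivative_at_alt
  proof (intro conjI allI impI)
    show "bounded_linear (\<lambda>h. h \<bullet> x)" by (rule bounded_linear_inner_left)
    fix r :: real assume "0 < r"
    obtain m where "m > 0" and m: "\<And>w. norm (w - v) \<le> m \<Longrightarrow>
      w \<bullet> x - p x \<le> ?c w \<and> ?c w \<le> w \<bullet> x - p x + r * norm (w - v)"
      using near[OF \<open>0 < r\<close>] by blast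
    have "norm (?c w - ?c v - (w - v) \<bullet> x) \<le> r * norm (w - v)" if "norm (w - v) < m" for w
      using m[of w] that unfolding cv by (auto simp: inner_diff_left)
    with \<open>m > 0\<close> show "\<exists>d>0. \<forall>w. norm (w - v) < d \<longrightarrow>
        norm (?c w - ?c v - (w - v) \<bullet> x) \<le> r * norm (w - v)" by blast
  qed
  then show ?thesis unfolding egrad_def by (rule GDERIV_imp_grad)
qed

section \<open>Minimizers of lower semicontinuous coercive functions\<close>

lemma coercive_fun_if_linear_growth:
  fixes F :: "'a::real_normed_vector \<Rightarrow> ereal"
  assumes "0 < m" and F: "\<And>x. ereal (c + m * norm x) \<le> F x"
  shows "coercive_fun F"
  unfolding coercive_fun_def tendsto_PInfty
proof
  fix r :: real
  have "ereal r < F x" if "(r - c) / m + 1 \<le> norm x" for x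
  proof -
    have "(r - c) / m < norm x" using that by linarith
    then have "r < c + m * norm x"
      using \<open>0 < m\<close> by (simp add: field_simps)
    then show ?thesis using F[of x] by (metis less_ereal.simps(1) less_le_trans)
  qed
  then show "eventually (\<lambda>x. ereal r < F x) at_infinity"
    unfolding eventually_at_infinity by blast
qed

lemma lsc_fun_open_superlevel:
  assumes "lsc_fun F"
  shows "open {x. a < F x}"
proof (rule Topological_Spaces.openI)
  fix x assume "x \<in> {x. a < F x}"
  then have ax: "a < F x" by simp
  also have "F x \<le> Liminf (at x) F" using assms by (simp add: lsc_fun_def)
  finally have "eventually (\<lambda>y. a < F y) (at x)" by (rule less_LiminfD)
  then obtain T where T: "open T" "x \<in> T" "\<forall>y\<in>T. y \<noteq> x \<longrightarrow> a < F y"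
    unfolding eventually_at_topological by blast
  then have "T \<subseteq> {x. a < F x}" using ax by auto
  then show "\<exists>T. open T \<and> x \<in> T \<and> T \<subseteq> {x. a < F x}" using T by blast
qed

text \<open>
  Were the infimum not attained, the open sets \<open>{x. F y < F x}\<close> with \<open>y \<in> K\<close> would cover \<open>K\<close>; but
  in a finite subcover, the \<open>y\<close> with the least value of \<open>F\<close> is not covered.
\<close>

lemma lsc_attains_min_on_compact:
  assumes lsc: "lsc_fun F" and K: "compact K" "K \<noteq> {}"
  shows "\<exists>x\<in>K. \<forall>y\<in>K. F x \<le> F y"
proof (rule ccontr)
  assume "\<not> ?thesis"
  then have none: "\<exists>y\<in>K. F y < F x" if "x \<in> K" for x
    using that by (auto simp: not_le)
  have cover: "K \<subseteq> (\<Union>y\<in>K. {x. F y < F x})" using none by auto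
  obtain D where D: "D \<subseteq> K" "finite D" "K \<subseteq> (\<Union>y\<in>D. {x. F y < F x})"
    using compactE_image[OF K(1) _ cover] lsc_fun_open_superlevel[OF lsc] by blast
  have "D \<noteq> {}" using D(3) K(2) by auto
  define z where "z = arg_min_on F D"
  have "z \<in> D" "\<And>y. y \<in> D \<Longrightarrow> \<not> F y < F z"
    using arg_min_if_finite[OF D(2) \<open>D \<noteq> {}\<close>, of F] by (auto simp: z_def)
  then show False using D(1,3) by blast
qed

lemma lsc_coercive_has_minimizer:
  fixes F :: "'a::euclidean_space \<Rightarrow> ereal"
  assumes lsc: "lsc_fun F" and co: "coercive_fun F"
  obtains x where "minimizer F x"
proof (cases "\<forall>x. F x = \<infinity>")
  case True
  then show thesis using that[of 0] by (simp add: minimizer_def)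
next
  case False
  then obtain x1 where "F x1 < \<infinity>" by auto
  then have "eventually (\<lambda>x. F x1 < F x) at_infinity"
    using co unfolding coercive_fun_def by (rule order_tendstoD(1)[rotated])
  then obtain b where b: "\<And>x. b \<le> norm x \<Longrightarrow> F x1 < F x"
    unfolding eventually_at_infinity by blast
  have x1: "x1 \<in> cball 0 b" using b[of x1] by (cases "b \<le> norm x1") auto
  then have "cball (0::'a) b \<noteq> {}" by blast
  then obtain x where x: "x \<in> cball 0 b" "\<And>y. y \<in> cball 0 b \<Longrightarrow> F x \<le> F y"
    using lsc_attains_min_on_compact[OF lsc compact_cball] by metis
  have "F x \<le> F y" for y
    using x(2)[of y] x(2)[OF x1] b[of y] by (cases "b \<le> norm y") auto
  then have "minimizer F x" by (simp add: minimizer_def)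
  then show thesis by (rule that)
qed

lemma lsc_fun_objective:
  fixes f :: "'a::t2_space \<Rightarrow> real"
  assumes cont: "continuous_on UNIV f" and lsc: "lsc_fun g" and ninf: "\<And>x. g x \<noteq> -\<infinity>"
  shows "lsc_fun (objective f g)"
  unfolding lsc_fun_def le_Liminf_iff
proof (intro allI impI)
  fix x a assume a: "a < objective f g x"
  have "\<exists>r. a \<le> ereal r \<and> ereal r < objective f g x"
    using ereal_dense2[OF a] less_imp_le by blast
  then obtain r where r: "a \<le> ereal r" "ereal r < objective f g x" by blast
  then have "ereal (r - f x) < g x"
    by (cases "g x") (auto simp: objective_def)
  then obtain b where b: "ereal (r - f x) < ereal b" "ereal b < g x"
    using ereal_dense2 by blast
  have "g x \<le> Liminf (at x) g" using lsc by (simp add: lsc_fun_def)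
  then have g: "eventually (\<lambda>z. ereal b < g z) (at x)"
    by (intro less_LiminfD less_le_trans[OF b(2)])
  have "(f \<longlongrightarrow> f x) (at x)" using cont by (simp add: continuous_on_def)
  then have f: "eventually (\<lambda>z. r - b < f z) (at x)"
    by (rule order_tendstoD(1)) (use b(1) in simp)
  show "eventually (\<lambda>z. a < objective f g z) (at x)"
    using f g
  proof eventually_elim
    case (elim z)
    have "ereal r < objective f g z"
      using elim by (cases "g z") (auto simp: objective_def)
    with r(1) show ?case by (rule le_less_trans)
  qed
qed

text \<open>
  If the conjugate is finite at \<open>u \<plusminus> e b\<close> for every basis vector \<open>b\<close>, then \<open>p - \<langle>u, \<cdot>\<rangle>\<close> dominates a
  positive multiple of the absolute value of every coordinate, up to a constant, and hence of the
  norm. It therefore has a minimizer, and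
  there the gradient of \<open>p\<close> equals \<open>u\<close>.
\<close>

lemma interior_conj_domain_subset_range_grad:
  fixes p :: "'a::euclidean_space \<Rightarrow> real"
  assumes diff: "\<And>x. p differentiable (at x)"
    and u: "u \<in> interior (edom (conj_fun (\<lambda>x. ereal (p x))))"
  shows "u \<in> range (grad p)"
proof -
  let ?c = "conj_fun (\<lambda>x. ereal (p x))"
  obtain e where "0 < e" and e: "cball u e \<subseteq> edom ?c"
    using u by (auto simp: mem_interior_cball)
  have "\<exists>C. ?c (u + e *\<^sub>R b) \<le> ereal C \<and> ?c (u - e *\<^sub>R b) \<le> ereal C" if "b \<in> Basis" for b
  proof -
    have "u + e *\<^sub>R b \<in> edom ?c" "u - e *\<^sub>R b \<in> edom ?c"
      using e \<open>0 < e\<close> that by (auto simp: subset_iff dist_norm)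
    then have "max (?c (u + e *\<^sub>R b)) (?c (u - e *\<^sub>R b)) < \<infinity>" by (simp add: edom_def max_def)
    from ereal_dense2[OF this] show ?thesis by (auto intro: less_imp_le)
  qed
  then obtain C where C: "\<And>b. b \<in> Basis \<Longrightarrow> ?c (u + e *\<^sub>R b) \<le> ereal (C b) \<and> ?c (u - e *\<^sub>R b) \<le> ereal (C b)"
    by metis
  define h where "h = (\<lambda>x. p x - u \<bullet> x)"
  have coord: "e * \<bar>x \<bullet> b\<bar> \<le> C b + h x" if "b \<in> Basis" for x b
  proof -
    have "ereal ((u + e *\<^sub>R b) \<bullet> x - p x) \<le> ereal (C b)" "ereal ((u - e *\<^sub>R b) \<bullet> x - p x) \<le> ereal (C b)"
      using C[OF that] conj_fun_ge_affine order_trans by blast+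
    then show ?thesis using \<open>0 < e\<close>
      by (auto simp: h_def inner_add_left inner_diff_left inner_commute[of b] abs_if)
  qed
  let ?N = "real (DIM('a))"
  have growth: "- (\<Sum>b\<in>Basis. C b) / ?N + (e / ?N) * norm x \<le> h x" for x
  proof -
    have "e * norm x \<le> e * (\<Sum>b\<in>Basis. \<bar>x \<bullet> b\<bar>)"
      using \<open>0 < e\<close> norm_le_l1 by (intro mult_left_mono) auto
    also have "\<dots> \<le> (\<Sum>b\<in>Basis. C b + h x)"
      unfolding sum_distrib_left by (rule sum_mono) (rule coord)
    also have "\<dots> = (\<Sum>b\<in>Basis. C b) + ?N * h x" by (simp add: sum.distrib)
    finally show ?thesis by (simp add: field_simps)
  qed
  have co: "coercive_fun (\<lambda>x. ereal (h x))"
    by (rule coercive_fun_if_linear_growth[of "e / ?N" "- (\<Sum>b\<in>Basis. C b) / ?N"])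
      (use growth \<open>0 < e\<close> in auto)
  have "lsc_fun (\<lambda>x. ereal (h x))"
  proof -
    have "continuous_on UNIV p"
      using diff by (simp add: continuous_on_eq_continuous_at differentiable_imp_continuous_within)
    then have "continuous_on UNIV h"
      unfolding h_def by (intro continuous_intros)
    then have "lsc_fun (objective h (\<lambda>_. 0))"
      by (rule lsc_fun_objective) (auto simp: lsc_fun_def le_Liminf_iff)
    moreover have "objective h (\<lambda>_. 0) = (\<lambda>x. ereal (h x))" by (simp add: objective_def fun_eq_iff)
    ultimately show ?thesis by simp
  qed
  then obtain x where x: "minimizer (\<lambda>x. ereal (h x)) x"
    using co by (rule lsc_coercive_has_minimizer)
  have sub: "p x + u \<bullet> (y - x) \<le> p y" for y
  proof -
    have "h x \<le> h y" using x by (simp add: minimizer_def)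
    then show ?thesis by (simp add: h_def inner_diff_right)
  qed
  have "u = grad p x"
    by (rule GDERIV_subgradient_eq[OF GDERIV_grad[OF diff] sub])
  then show ?thesis by simp
qed

lemma interior_edom_conj_fun_reflect:
  fixes h :: "'a::euclidean_space \<Rightarrow> ereal"
  shows "w \<in> interior (edom (conj_fun (\<lambda>x. h (- x)))) \<longleftrightarrow> - w \<in> interior (edom (conj_fun h))"
proof -
  have "conj_fun (\<lambda>x. h (- x)) v = conj_fun h (- v)" for v
  proof -
    have "(SUP x. ereal (v \<bullet> x) - h (- x)) = Sup ((\<lambda>x. ereal ((- v) \<bullet> x) - h x) ` range uminus)"
      by (simp only: image_image inner_minus_left inner_minus_right minus_minus)
    then show ?thesis by (simp only: conj_fun_def surj_uminus)
  qed
  then have "edom (conj_fun (\<lambda>x. h (- x))) = uminus ` edom (conj_fun h)"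
    by (force simp: edom_def image_iff)
  then show ?thesis by (force simp: interior_negations)
qed

section \<open>The regularized gap\<close>

text \<open>
  The point \<open>(1 - t) xb + t z\<close> with \<open>t = c * \<mu>\<close> is the right competitor because the scaling
  \<open>inverse c\<close> in the model then turns its displacement into \<open>\<mu> (z - xb)\<close>, so the model increment is
  \<open>t\<close> times the increment in the strong convexity inequality \<open>sc\<close>.
\<close>

lemma fb_envelope_le_interpolation:
  fixes p :: "'a::euclidean_space \<Rightarrow> real"
  assumes "0 < \<mu>" "0 < c" "c * \<mu> \<le> 1"
    and sc: "f xb + (1 / \<mu>) * (p (\<mu> *\<^sub>R (z - xb) + y) - p y) \<le> f z"
    and y: "y = egrad (conj_fun (\<lambda>x. ereal (p x))) (grad f xb)"
    and g: "convex_fun g" "g xb = ereal a" "g z = ereal b"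
  shows "fb_envelope (\<lambda>x. ereal (p x)) f g c xb
      \<le> ereal ((1 - c * \<mu>) * (f xb + a) + c * \<mu> * (f z + b))"
proof -
  define t where "t = c * \<mu>"
  define x where "x = (1 - t) *\<^sub>R xb + t *\<^sub>R z"
  have t: "0 < t" "t \<le> 1" using assms by (simp_all add: t_def)
  have xd: "x - xb = t *\<^sub>R (z - xb)" by (simp add: x_def algebra_simps)
  have "inverse c *\<^sub>R (x - xb + c *\<^sub>R y) = \<mu> *\<^sub>R (z - xb) + y"
    using \<open>0 < c\<close> by (simp add: xd t_def scaleR_add_right)
  then have "epi_scale c (\<lambda>x. ereal (p x)) (x - xb + c *\<^sub>R y) = ereal (c * p (\<mu> *\<^sub>R (z - xb) + y))"
      "epi_scale c (\<lambda>x. ereal (p x)) (c *\<^sub>R y) = ereal (c * p y)"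
    using \<open>0 < c\<close> by (simp_all add: epi_scale_def)
  moreover have "g x \<le> ereal ((1 - t) * a + t * b)"
    unfolding x_def by (rule convex_fun_segment_le) (use g t in auto)
  ultimately have "ereal (f xb) + epi_scale c (\<lambda>x. ereal (p x)) (x - xb + c *\<^sub>R y)
        - epi_scale c (\<lambda>x. ereal (p x)) (c *\<^sub>R y) + g x
      \<le> ereal (f xb + c * p (\<mu> *\<^sub>R (z - xb) + y) - c * p y + ((1 - t) * a + t * b))"
    by (cases "g x") auto
  also have "\<dots> \<le> ereal ((1 - t) * (f xb + a) + t * (f z + b))"
  proof -
    have "t * (f xb + (1 / \<mu>) * (p (\<mu> *\<^sub>R (z - xb) + y) - p y)) \<le> t * f z"
      using sc t by (intro mult_left_mono) auto
    moreover have "t * (1 / \<mu>) = c" using \<open>0 < \<mu>\<close> by (simp add: t_def)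
    ultimately have "t * f xb + c * (p (\<mu> *\<^sub>R (z - xb) + y) - p y) \<le> t * f z"
      by (simp only: distrib_left flip: mult.assoc)
    then show ?thesis by (simp add: algebra_simps)
  qed
  finally show ?thesis
    unfolding fb_envelope_def y[symmetric] t_def[symmetric] by (rule INF_lower2[OF UNIV_I])
qed

text \<open>
  Dividing the interpolation bound by \<open>c\<close> gives the claim when all values are finite. If
  \<open>g xb = \<infinity>\<close> or the envelope is \<open>-\<infinity>\<close>, the right-hand side is \<open>\<infinity>\<close>; in the former case this
  uses that \<open>\<infinity> - a = \<infinity>\<close> in \<open>ereal\<close> for every \<open>a\<close>, including \<open>a = \<infinity>\<close>.
\<close>

lemma dominance_if_fb_envelope_le:
  assumes "0 < \<mu>" "0 < c" and g: "g xb \<noteq> -\<infinity>" "g z = ereal b"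
    and env: "\<And>a. g xb = ereal a \<Longrightarrow>
      fb_envelope \<phi> f g c xb \<le> ereal ((1 - c * \<mu>) * (f xb + a) + c * \<mu> * (f z + b))"
  shows "ereal \<mu> * (objective f g xb - objective f g z) \<le> reg_gap \<phi> f g xb c"
proof (cases "g xb")
  case PInf
  then show ?thesis using \<open>0 < c\<close>
    by (simp add: reg_gap_def objective_def)
next
  case (real a)
  show ?thesis
  proof (cases "fb_envelope \<phi> f g c xb")
    case PInf
    with env[OF real] show ?thesis by simp
  next
    case MInf
    then show ?thesis using \<open>0 < c\<close> by (simp add: reg_gap_def objective_def real)
  next
    case (real E)
    have "c * (\<mu> * ((f xb + a) - (f z + b))) \<le> f xb + a - E"
      using env[OF \<open>g xb = ereal a\<close>] unfolding real by (simp add: algebra_simps)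
    then have "\<mu> * ((f xb + a) - (f z + b)) \<le> (1 / c) * (f xb + a - E)"
      using \<open>0 < c\<close> by (simp add: field_simps)
    then show ?thesis using g(2) \<open>g xb = ereal a\<close> by (simp add: reg_gap_def objective_def real)
  qed
qed (use g in auto)

section \<open>The composite objective\<close>

lemma strictly_convex_fun_on_objective:
  fixes f :: "'a::real_vector \<Rightarrow> real"
  assumes f: "\<And>x y t. x \<noteq> y \<Longrightarrow> 0 < t \<Longrightarrow> t < 1 \<Longrightarrow>
      f ((1 - t) *\<^sub>R x + t *\<^sub>R y) < (1 - t) * f x + t * f y"
    and g: "convex_fun g" "\<And>x. g x \<noteq> -\<infinity>"
  shows "strictly_convex_fun_on (edom (objective f g)) (objective f g)"
  unfolding strictly_convex_fun_on_def
proof (intro ballI allI impI)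
  fix x y :: 'a and t :: real
  assume x: "x \<in> edom (objective f g)" and y: "y \<in> edom (objective f g)"
    and "x \<noteq> y" and t: "0 < t" "t < 1"
  obtain a where a: "g x = ereal a"
    using x g(2)[of x] by (cases "g x") (auto simp: edom_def objective_def)
  obtain b where b: "g y = ereal b"
    using y g(2)[of y] by (cases "g y") (auto simp: edom_def objective_def)
  let ?z = "(1 - t) *\<^sub>R x + t *\<^sub>R y"
  have "g ?z \<le> ereal ((1 - t) * a + t * b)"
    by (rule convex_fun_segment_le) (use g a b t in auto)
  moreover have "f ?z < (1 - t) * f x + t * f y" by (rule f) fact+
  ultimately show "objective f g ?z < ereal (1 - t) * objective f g x + ereal t * objective f g y"
    using g(2)[of ?z] by (cases "g ?z") (auto simp: objective_def a b algebra_simps)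
qed

lemma strictly_convex_minimizer_unique:
  assumes str: "strictly_convex_fun_on (edom F) F" and "F x < \<infinity>" "F x \<noteq> -\<infinity>"
    and x: "minimizer F x" and y: "minimizer F y"
  shows "y = x"
proof (rule ccontr)
  assume "y \<noteq> x"
  have eq: "F y = F x" using x y by (simp add: minimizer_def order_antisym)
  have "F ((1 - 1/2) *\<^sub>R x + (1/2) *\<^sub>R y) < ereal (1 - 1/2) * F x + ereal (1/2) * F y"
    using str[unfolded strictly_convex_fun_on_def, rule_format, of x y "1/2"] assms(2) \<open>y \<noteq> x\<close> eq
    by (auto simp: edom_def)
  also have "\<dots> = F x" using assms(2,3) eq by (cases "F x") auto
  finally show False using x by (simp add: minimizer_def leD)
qed

lemma proper_conj_domain_affine_minorant:
  assumes "conj_fun g w < \<infinity>" "\<And>x. g x \<noteq> -\<infinity>"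
  obtains C where "\<And>x. ereal (w \<bullet> x - C) \<le> g x"
proof -
  obtain C where C: "conj_fun g w < ereal C"
    using ereal_dense2[OF assms(1)] by blast
  have "ereal (w \<bullet> x - C) \<le> g x" for x
  proof -
    have "ereal (w \<bullet> x) - g x \<le> conj_fun g w"
      unfolding conj_fun_def by (rule SUP_upper) simp
    then have "ereal (w \<bullet> x) - g x \<le> ereal C" using C by simp
    then show ?thesis using assms(2)[of x] by (cases "g x") auto
  qed
  then show thesis using that by blast
qed

text \<open>
  The tilted function \<open>f + \<langle>w, \<cdot>\<rangle>\<close> has the strict minimizer \<open>x0\<close> and so grows linearly, and the
  tilt is paid for by the affine minorant of \<open>g\<close> with slope \<open>w\<close>.
\<close>

lemma coercive_fun_objective:
  fixes f :: "'a::euclidean_space \<Rightarrow> real"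
  assumes conv: "convex_on UNIV f"
    and strict: "\<And>x. x \<noteq> x0 \<Longrightarrow> f x0 + (- w) \<bullet> (x - x0) < f x"
    and g: "\<And>x. ereal (w \<bullet> x - C) \<le> g x"
  shows "coercive_fun (objective f g)"
proof -
  define h where "h = (\<lambda>x. f x + w \<bullet> x)"
  have h: "h x0 < h x" if "x \<noteq> x0" for x
    using strict[OF that] by (simp add: h_def inner_diff_right)
  have "convex_on UNIV h" unfolding h_def by (rule convex_on_add_inner[OF conv])
  then obtain m where "0 < m" and m: "\<And>x. 1 \<le> norm (x - x0) \<Longrightarrow> h x0 + m * norm (x - x0) \<le> h x"
    using convex_strict_min_linear_growth[of h x0 1] h by auto
  have growth: "h x0 - m - m * norm x0 + m * norm x \<le> h x" for x
  proof (cases "1 \<le> norm (x - x0)")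
    case True
    have "norm x \<le> norm (x - x0) + norm x0" by (metis diff_add_cancel norm_triangle_ineq)
    then have "m * norm x \<le> m * (norm (x - x0) + norm x0)"
      using \<open>0 < m\<close> by (intro mult_left_mono) auto
    then show ?thesis using m[OF True] \<open>0 < m\<close> by (simp add: algebra_simps)
  next
    case False
    have "norm x \<le> norm (x - x0) + norm x0" by (metis diff_add_cancel norm_triangle_ineq)
    then have "m * norm x \<le> m * (1 + norm x0)"
      using \<open>0 < m\<close> False by (intro mult_left_mono) auto
    moreover have "h x0 \<le> h x" using h[of x] by (cases "x = x0") auto
    ultimately show ?thesis by (simp add: algebra_simps)
  qed
  have "ereal ((h x0 - m - m * norm x0 - C) + m * norm x) \<le> objective f g x" for x
    using growth[of x] g[of x] by (cases "g x") (auto simp: objective_def h_def)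
  then show ?thesis by (rule coercive_fun_if_linear_growth[OF \<open>0 < m\<close>])
qed

section \<open>Coercivity, strict convexity and dominance\<close>

theorem proposition5p10:
  fixes \<phi> :: "real ^ 'n \<Rightarrow> ereal"
    and f :: "real ^ 'n \<Rightarrow> real"
    and g :: "real ^ 'n \<Rightarrow> ereal"
    and L \<mu> :: real
  assumes "reference_function \<phi>"
    and "C1_fun f"
    and "L > 0"
    and "aniso_descent \<phi> L f"
    and "g \<in> Gamma0"
    and "(INF x. objective f g x) > -\<infinity>"
    and "edom (conj_fun g) \<inter> interior (edom (conj_fun (\<lambda>x. \<phi> (- x)))) \<noteq> {}"
    and "\<mu> > 0"
    and "aniso_strongly_convex \<phi> \<mu> (\<lambda>x. ereal (f x))"
  shows "range (grad f) = range (egrad \<phi>)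
    \<and> coercive_fun (objective f g)
    \<and> strictly_convex_fun_on (edom (objective f g)) (objective f g)
    \<and> (\<exists>xs. minimizer (objective f g) xs
          \<and> (\<forall>y. minimizer (objective f g) y \<longrightarrow> y = xs)
          \<and> (\<forall>c. 0 < c \<and> c \<le> inverse \<mu> \<longrightarrow>
                aniso_pg_dominance \<phi> f g \<mu> c
                \<and> (\<forall>xb. ereal \<mu> * (objective f g xb - objective f g xs)
                          \<le> reg_gap \<phi> f g xb c)))"
proof -
  define p where "p = (\<lambda>x. real_of_ereal (\<phi> x))"
  have \<phi>: "\<phi> \<in> Gamma0" "edom \<phi> = UNIV" "essentially_smooth \<phi>" "essentially_strictly_convex \<phi>"
    using assms(1) by (simp_all add: reference_function_def legendre_def)
  have \<phi>_real: "\<phi> = (\<lambda>x. ereal (p x))"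
  proof
    fix x
    have "\<phi> x < \<infinity>" "\<phi> x \<noteq> -\<infinity>"
      using \<phi>(1,2) by (auto simp: Gamma0_def proper_fun_def edom_def)
    then show "\<phi> x = ereal (p x)" by (cases "\<phi> x") (auto simp: p_def)
  qed
  have grad_p: "egrad \<phi> = grad p" by (simp add: egrad_def p_def)
  have p_conv: "convex_on UNIV p"
    using \<phi>(1) by (simp add: Gamma0_def \<phi>_real convex_fun_ereal_iff)
  have p_diff: "p differentiable (at x)" for x
    using \<phi>(2,3) by (simp add: essentially_smooth_def p_def)
  have p_above: "p x + grad p x \<bullet> (y - x) \<le> p y" for x y
    by (rule convex_on_above_gradient[OF p_conv GDERIV_grad[OF p_diff]])
  \<comment> \<open>Gradients are subgradients, so the subdifferential is nonempty everywhere and essential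
    strict convexity is strict convexity on the whole space.\<close>
  have "strictly_convex_fun_on UNIV \<phi>"
  proof -
    have "grad p x \<in> subdiff \<phi> x" for x
      using p_above by (simp add: subdiff_def \<phi>_real)
    then have "UNIV \<subseteq> {x. subdiff \<phi> x \<noteq> {}}" by blast
    then show ?thesis using \<phi>(4) by (simp add: essentially_strictly_convex_def)
  qed
  then have p_strict: "p x + grad p x \<bullet> (y - x) < p y" if "y \<noteq> x" for x y
    using strictly_convex_above_gradient[OF p_conv _ GDERIV_grad[OF p_diff] that]
    by (simp add: \<phi>_real)

  have f_conv: "convex_on UNIV f"
    using assms(9) by (simp add: aniso_strongly_convex_def Gamma0_def convex_fun_ereal_iff)
  have f_diff: "f differentiable (at x)" for x
    using assms(2) by (simp add: C1_fun_def)
  have f_above: "f x + grad f x \<bullet> (y - x) \<le> f y" for x y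
    by (rule convex_on_above_gradient[OF f_conv GDERIV_grad[OF f_diff]])
  have f_subdiff: "v \<in> subdiff (\<lambda>x. ereal (f x)) x \<longleftrightarrow> v = grad f x" for v x
    using f_above GDERIV_subgradient_eq[OF GDERIV_grad[OF f_diff]]
    by (auto simp: subdiff_def)

  have ranges: "range (grad f) = range (egrad \<phi>)"
  proof
    show "range (grad f) \<subseteq> range (egrad \<phi>)"
      using assms(4) by (simp add: aniso_descent_def)
    show "range (egrad \<phi>) \<subseteq> range (grad f)"
      using assms(9) by (auto simp: aniso_strongly_convex_def f_subdiff)
  qed

  \<comment> \<open>The mirror point of \<open>x\<close>: by the equality of ranges \<open>\<nabla>f x = \<nabla>p u\<close> for some \<open>u\<close>, and inverting
    \<open>\<nabla>p\<close> at a gradient identifies \<open>y x\<close> with \<open>u\<close>.\<close>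
  define y where "y x = egrad (conj_fun \<phi>) (grad f x)" for x
  have y: "grad p (y x) = grad f x" "grad f x \<in> interior (edom (conj_fun \<phi>))" for x
  proof -
    obtain u where u: "grad f x = grad p u" using ranges grad_p by (metis UNIV_I image_iff)
    then have "y x = u"
      unfolding y_def \<phi>_real u by (intro egrad_conj_fun_at_gradient[OF p_conv p_strict])
    then show "grad p (y x) = grad f x" by (simp add: u)
    show "grad f x \<in> interior (edom (conj_fun \<phi>))"
      unfolding \<phi>_real u by (rule gradient_in_interior_conj_domain[OF p_conv p_strict])
  qed
  have strong: "f x + (1 / \<mu>) * (p (\<mu> *\<^sub>R (z - x) + y x) - p (y x)) \<le> f z" for x z
  proof -
    have "ereal (f z) \<ge> ereal (f x)
        + epi_scale (1/\<mu>) \<phi> (z - x + inverse \<mu> *\<^sub>R y x)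
        - epi_scale (1/\<mu>) \<phi> (inverse \<mu> *\<^sub>R y x)"
      using assms(9) y(2) f_subdiff unfolding aniso_strongly_convex_def y_def by blast
    then show ?thesis
      using \<open>\<mu> > 0\<close> by (simp add: epi_scale_def \<phi>_real scaleR_add_right right_diff_distrib)
  qed
  have f_strict: "f x + grad f x \<bullet> (z - x) < f z" if "z \<noteq> x" for x z
  proof -
    have "p (y x) + grad p (y x) \<bullet> ((\<mu> *\<^sub>R (z - x) + y x) - y x) < p (\<mu> *\<^sub>R (z - x) + y x)"
      by (rule p_strict) (use that \<open>\<mu> > 0\<close> in simp)
    then have "\<mu> * (grad f x \<bullet> (z - x)) < p (\<mu> *\<^sub>R (z - x) + y x) - p (y x)"
      by (simp add: y(1))
    then have "grad f x \<bullet> (z - x) < (1 / \<mu>) * (p (\<mu> *\<^sub>R (z - x) + y x) - p (y x))"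
      using \<open>\<mu> > 0\<close> by (simp add: field_simps)
    with strong[of x z] show ?thesis by linarith
  qed

  have g: "lsc_fun g" "convex_fun g" "g x \<noteq> -\<infinity>" "edom g \<noteq> {}" for x
    using assms(5) by (auto simp: Gamma0_def proper_fun_def)

  have co: "coercive_fun (objective f g)"
  proof -
    obtain w where w: "conj_fun g w < \<infinity>" "w \<in> interior (edom (conj_fun (\<lambda>x. \<phi> (- x))))"
      using assms(7) by (auto simp: edom_def)
    then have "- w \<in> range (grad p)"
      using interior_conj_domain_subset_range_grad[OF p_diff, of "- w"]
      by (simp only: interior_edom_conj_fun_reflect) (simp only: \<phi>_real)
    then obtain x0 where x0: "- w = grad f x0" using ranges grad_p by (metis image_iff)
    obtain C where C: "\<And>x. ereal (w \<bullet> x - C) \<le> g x"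
      using proper_conj_domain_affine_minorant[OF w(1) g(3)] by blast
    show ?thesis
      by (rule coercive_fun_objective[OF f_conv _ C, of x0]) (use f_strict x0 in simp)
  qed

  have str: "strictly_convex_fun_on (edom (objective f g)) (objective f g)"
    using strictly_convex_if_above_tangents[of f "grad f"] f_strict
    by (intro strictly_convex_fun_on_objective g(2,3)) auto

  have "continuous_on UNIV f"
    by (rule convex_on_continuous[OF open_UNIV f_conv])
  then have "lsc_fun (objective f g)" by (rule lsc_fun_objective) (rule g)+
  then obtain xs where xs: "minimizer (objective f g) xs"
    using co by (rule lsc_coercive_has_minimizer)
  obtain b where b: "g xs = ereal b"
  proof -
    obtain x1 where "g x1 < \<infinity>" using g(4) by (auto simp: edom_def)
    then have "objective f g x1 < \<infinity>" by (simp add: objective_def)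
    then have "objective f g xs < \<infinity>"
      using xs unfolding minimizer_def by (blast intro: le_less_trans)
    then have "g xs \<noteq> \<infinity>" by (auto simp: objective_def)
    then show thesis using that g(3)[of xs] by (cases "g xs") auto
  qed
  have inf: "(INF x. objective f g x) = objective f g xs"
    using xs by (intro antisym INF_lower INF_greatest) (auto simp: minimizer_def)
  have dom: "ereal \<mu> * (objective f g xb - objective f g xs) \<le> reg_gap \<phi> f g xb c"
    if c: "0 < c" "c \<le> inverse \<mu>" for c xb
  proof (rule dominance_if_fb_envelope_le[where b = b])
    show "\<mu> > 0" "0 < c" "g xb \<noteq> -\<infinity>" "g xs = ereal b" by fact+
    have "c * \<mu> \<le> 1" using c \<open>\<mu> > 0\<close> by (simp add: field_simps)
    fix a assume "g xb = ereal a"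
    show "fb_envelope \<phi> f g c xb \<le> ereal ((1 - c * \<mu>) * (f xb + a) + c * \<mu> * (f xs + b))"
      unfolding \<phi>_real
      by (rule fb_envelope_le_interpolation[OF \<open>\<mu> > 0\<close> \<open>0 < c\<close> \<open>c * \<mu> \<le> 1\<close> strong
            y_def[unfolded \<phi>_real] g(2) \<open>g xb = ereal a\<close> b])
  qed
  have pg: "aniso_pg_dominance \<phi> f g \<mu> c" if "0 < c" "c \<le> inverse \<mu>" for c
    using dom[OF that] by (simp add: aniso_pg_dominance_def inf)
  show ?thesis
  proof (intro conjI exI[of _ xs] allI impI)
    show "x = xs" if "minimizer (objective f g) x" for x
      by (rule strictly_convex_minimizer_unique[OF str _ _ xs that]) (simp_all add: objective_def b)
  qed (use ranges co str xs pg dom in blast)+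
qed

end
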